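(* Let $\mathfrak A$ be an HTM and $\mu$ be an $\mathfrak A$-valued premeasure. Then there exists a unique $\mathfrak A$-valued measure $\nu$ such that $\nu\asymp\mu$.
   Context: Monoids and groups are Abelian and written additively. An HTM is a monoid with a Hausdorff topology making addition continuous. For a map $f$, $D_f$ denotes its domain. "Countable" includes finite and empty. A ring is a nonempty set $\mathcal Q$ of sets such that $A\cup B\in\mathcal Q$ and $A\setminus B\in\mathcal Q$ for all $A,B\in\mathcal Q$. A $\delta$-ring is a ring closed under intersections of nonempty countable families; a $\sigma$-ring is a ring closed under countable unions. For a set of sets $\mathcal K$, $\sigma(\mathcal K)$ is the smallest $\sigma$-ring containing $\mathcal K$. A family $\mathbf A\colon I\to\mathcal Q$ is a partition of $A$ (into elements of $\mathcal Q$) if $\mathbf A(i)\cap\mathbf A(j)=\varnothing$ for $i\ne j$ and $\bigcup_{i\in I}\mathbf A(i)=A$ (members may be empty and $I$ may be empty); it is countable if $I$ is countable. A family $f\colon I\to\mathfrak A$ in an HTM is summable in $\mathfrak A$ if the net $J\mapsto\sum_{i\in J}f(i)$ over the finite subsets $J\subset I$, directed by inclusion, converges in $\mathfrak A$; its limit is denoted $\sum f=\sum_{i\in I}f(i)$. An $\mathfrak A$-valued premeasure is a map $\mu\colon D_\mu\to\mathfrak A$ whose domain $D_\mu$ is a $\delta$-ring and which is $\sigma$-additive: for every $A\in D_\mu$ and every countable partition $\mathbf A$ of $A$ into elements of $D_\mu$, the family $\mu\circ\mathbf A$ is summable in $\mathfrak A$ and $\mu(A)=\sum\mu\circ\mathbf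 A$. The host $\sigma$-ring of a map $\mu$ is $\mathscr H[\mu]=\sigma(D_\mu)$. Maps $\mu,\nu$ are similar, $\mu\asymp\nu$, if $\mathscr H[\mu]=\mathscr H[\nu]$ and $\mu,\nu$ coincide on $D_\mu\cap D_\nu$. An $\mathfrak A$-valued measure is an $\mathfrak A$-valued premeasure $\mu$ which is an extension of every $\mathfrak A$-valued premeasure $\nu$ such that $\nu\asymp\mu$. *)

theory Defs
  imports "HOL-Analysis.Analysis"
begin

text \<open>
  An HTM is a type of sort \<open>{topological_comm_monoid_add, t2_space}\<close>.  A map \<open>\<mu>\<close> defined on a set
  of sets is a partial map \<open>'x set \<rightharpoonup> 'a\<close>, with \<open>dom \<mu>\<close> for \<open>D\<^sub>\<mu>\<close>; hence equality of maps means equal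
  domains and equal values.
\<close>

lemma ring_of_sets_UNIV_iff:
  "ring_of_sets UNIV Q \<longleftrightarrow> Q \<noteq> {} \<and> (\<forall>A\<in>Q. \<forall>B\<in>Q. A \<union> B \<in> Q \<and> A - B \<in> Q)"
  unfolding ring_of_sets_iff by (auto, metis Diff_cancel)

definition delta_ring :: "'x set set \<Rightarrow> bool" where
  "delta_ring Q \<longleftrightarrow> ring_of_sets UNIV Q \<and>
     (\<forall>C. C \<subseteq> Q \<longrightarrow> C \<noteq> {} \<longrightarrow> countable C \<longrightarrow> \<Inter>C \<in> Q)"

definition sigma_ring :: "'x set set \<Rightarrow> bool" where
  "sigma_ring Q \<longleftrightarrow> ring_of_sets UNIV Q \<and> (\<forall>C. C \<subseteq> Q \<longrightarrow> countable C \<longrightarrow> \<Union>C \<in> Q)"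

lemma sigma_ring_Inter:
  assumes "\<And>Q. Q \<in> \<Q> \<Longrightarrow> sigma_ring Q"
  shows "sigma_ring (\<Inter>\<Q>)"
proof -
  have "{} \<in> Q" if "Q \<in> \<Q>" for Q
    using assms[OF that] by (auto simp: sigma_ring_def ring_of_sets_iff)
  then have "\<Inter>\<Q> \<noteq> {}" by blast
  then show ?thesis
    using assms unfolding sigma_ring_def ring_of_sets_UNIV_iff
    by (simp add: subset_iff)
qed

lemma sigma_ring_hull: "sigma_ring (sigma_ring hull K)"
  by (rule hull_in) (simp add: sigma_ring_Inter)

definition partition_into :: "'x set set \<Rightarrow> ('i \<Rightarrow> 'x set) \<Rightarrow> 'i set \<Rightarrow> 'x set \<Rightarrow> bool" where
  "partition_into Q P I A \<longleftrightarrow> P ` I \<subseteq> Q \<and> disjoint_family_on P I \<and> (\<Union>i\<in>I. P i) = A"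

text \<open>
  Countable families are indexed by arbitrary subsets of \<open>nat\<close>, possibly finite or empty; this
  covers every countable index set up to reindexing (lemma \<open>htm_premeasure_countable\<close> below).
\<close>

definition htm_premeasure ::
    "('x set \<rightharpoonup> 'a::{topological_comm_monoid_add, t2_space}) \<Rightarrow> bool" where
  "htm_premeasure \<mu> \<longleftrightarrow> delta_ring (dom \<mu>) \<and>
     (\<forall>A\<in>dom \<mu>. \<forall>I :: nat set. \<forall>P. partition_into (dom \<mu>) P I A \<longrightarrow>
        (\<lambda>i. the (\<mu> (P i))) summable_on I \<and> the (\<mu> A) = (\<Sum>\<^sub>\<infinity>i\<in>I. the (\<mu> (P i))))"

lemma htm_premeasure_countable:
  fixes \<mu> :: "'x set \<rightharpoonup> 'a::{topological_comm_monoid_add, t2_space}" and I :: "'i set"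
  assumes "htm_premeasure \<mu>" "A \<in> dom \<mu>" "countable I" "partition_into (dom \<mu>) P I A"
  shows "(\<lambda>i. the (\<mu> (P i))) summable_on I \<and> the (\<mu> A) = (\<Sum>\<^sub>\<infinity>i\<in>I. the (\<mu> (P i)))"
proof -
  obtain f :: "'i \<Rightarrow> nat" where f: "inj_on f I"
    using assms(3) by (auto simp: countable_def)
  define J and g where "J = f ` I" and "g = inv_into I f"
  have g: "bij_betw g J I"
    unfolding J_def g_def using f by (simp add: bij_betw_inv_into inj_on_imp_bij_betw)
  then have gJ: "g ` J = I" and inj: "inj_on g J" by (auto simp: bij_betw_def)
  have "partition_into (dom \<mu>) (\<lambda>j. P (g j)) J A"
  proof -
    have "disjoint_family_on (\<lambda>j. P (g j)) J"
      using assms(4) gJ inj unfolding partition_into_def disjoint_family_on_def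
      by (metis imageI inj_onD)
    with assms(4) show ?thesis
      unfolding gJ[symmetric] partition_into_def by (simp add: image_image)
  qed
  then have "(\<lambda>j. the (\<mu> (P (g j)))) summable_on J \<and>
      the (\<mu> A) = (\<Sum>\<^sub>\<infinity>j\<in>J. the (\<mu> (P (g j))))"
    using assms(1,2) unfolding htm_premeasure_def by simp
  then show ?thesis
    using summable_on_reindex_bij_betw[OF g, of "\<lambda>i. the (\<mu> (P i))"]
      infsum_reindex_bij_betw[OF g, of "\<lambda>i. the (\<mu> (P i))"] by simp
qed

definition host :: "('x set \<rightharpoonup> 'a) \<Rightarrow> 'x set set" where
  "host \<mu> = sigma_ring hull (dom \<mu>)"

definition similar :: "('x set \<rightharpoonup> 'a) \<Rightarrow> ('x set \<rightharpoonup> 'a) \<Rightarrow> bool"  (infix "\<asymp>" 50) where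
  "\<mu> \<asymp> \<nu> \<longleftrightarrow> host \<mu> = host \<nu> \<and> (\<forall>A \<in> dom \<mu> \<inter> dom \<nu>. \<mu> A = \<nu> A)"

definition htm_measure ::
    "('x set \<rightharpoonup> 'a::{topological_comm_monoid_add, t2_space}) \<Rightarrow> bool" where
  "htm_measure \<mu> \<longleftrightarrow> htm_premeasure \<mu> \<and> (\<forall>\<nu>. htm_premeasure \<nu> \<and> \<nu> \<asymp> \<mu> \<longrightarrow> \<nu> \<subseteq>\<^sub>m \<mu>)"

end

theory Submission
  imports Defs
begin

text \<open>
  Inside its host \<open>\<sigma>\<close>-ring, the domain of a premeasure is an ideal whose countable unions exhaust the
  host.  Hence similarity is transitive among premeasures, and two similar premeasures \<open>\<mu>\<close>, \<open>\<nu>\<close> have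
  a common similar extension \<open>A \<union> B \<mapsto> \<mu> A + \<nu> B\<close>, defined for disjoint \<open>A \<in> dom \<mu>\<close> and
  \<open>B \<in> dom \<nu>\<close>.  The premeasures similar to \<open>\<mu>\<close> therefore form a directed family.  Since a partition of
  \<open>A\<close> lies in every ideal containing \<open>A\<close>, the union of this family is again a premeasure, and it is
  the largest one.
\<close>

section \<open>Delta-rings inside the sigma-rings they generate\<close>

lemma sigma_ring_closed:
  assumes "sigma_ring H"
  shows "{} \<in> H" "A \<in> H \<Longrightarrow> B \<in> H \<Longrightarrow> A \<union> B \<in> H" "A \<in> H \<Longrightarrow> B \<in> H \<Longrightarrow> A - B \<in> H"
    "C \<subseteq> H \<Longrightarrow> countable C \<Longrightarrow> \<Union>C \<in> H"
  using assms by (auto simp: sigma_ring_def ring_of_sets_iff)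

lemma delta_ring_closed:
  assumes "delta_ring D"
  shows "{} \<in> D" "A \<in> D \<Longrightarrow> B \<in> D \<Longrightarrow> A \<union> B \<in> D" "A \<in> D \<Longrightarrow> B \<in> D \<Longrightarrow> A - B \<in> D"
    "C \<subseteq> D \<Longrightarrow> C \<noteq> {} \<Longrightarrow> countable C \<Longrightarrow> \<Inter>C \<in> D"
  using assms by (auto simp: delta_ring_def ring_of_sets_iff)

lemma delta_ring_Int:
  assumes "delta_ring D" "A \<in> D" "B \<in> D"
  shows "A \<inter> B \<in> D"
  using delta_ring_closed(4)[OF assms(1), of "{A, B}"] assms by simp

text \<open>De Morgan inside \<open>X\<close>: the union is complementary in \<open>X\<close> to the
  intersection of the sets \<open>X - X \<inter> Y\<close>. That intersection is available only for
  a nonempty family, hence the case split.\<close>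

lemma delta_ring_UN_sub:
  assumes D: "delta_ring D" and "X \<in> D" "countable C" "\<And>Y. Y \<in> C \<Longrightarrow> X \<inter> Y \<in> D"
  shows "X \<inter> \<Union>C \<in> D"
proof (cases "C = {}")
  case True
  then show ?thesis using delta_ring_closed(1)[OF D] by simp
next
  case False
  have "\<Inter>((\<lambda>Y. X - X \<inter> Y) ` C) \<in> D"
    using assms False by (intro delta_ring_closed(4)[OF D]) (auto intro: delta_ring_closed(3)[OF D])
  then have "X - \<Inter>((\<lambda>Y. X - X \<inter> Y) ` C) \<in> D"
    using \<open>X \<in> D\<close> by (intro delta_ring_closed(3)[OF D])
  moreover have "X - \<Inter>((\<lambda>Y. X - X \<inter> Y) ` C) = X \<inter> \<Union>C" using False by auto
  ultimately show ?thesis by simp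
qed

text \<open>The sets whose trace on every member of \<open>D\<close> lies in \<open>D\<close> form a
  sigma-ring containing \<open>D\<close>, hence containing the hull. Countable unions are handled by
  \<open>delta_ring_UN_sub\<close>.\<close>

lemma delta_ring_ideal:
  assumes D: "delta_ring D" and "X \<in> D" "Y \<in> sigma_ring hull D" "Y \<subseteq> X"
  shows "Y \<in> D"
proof -
  let ?H = "{Y. \<forall>X\<in>D. X \<inter> Y \<in> D}"
  have "sigma_ring ?H"
    unfolding sigma_ring_def ring_of_sets_UNIV_iff
  proof (intro conjI ballI allI impI)
    show "?H \<noteq> {}" using delta_ring_closed(1)[OF D] by (auto intro!: exI[of _ "{}"])
  next
    fix A B assume AB: "A \<in> ?H" "B \<in> ?H"
    have "X \<inter> (A \<union> B) = X \<inter> A \<union> X \<inter> B" "X \<inter> (A - B) = X \<inter> A - X \<inter> B" for X by auto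
    with AB show "A \<union> B \<in> ?H" "A - B \<in> ?H" by (simp_all add: delta_ring_closed(2,3)[OF D])
  next
    fix C assume "C \<subseteq> ?H" "countable C"
    then show "\<Union>C \<in> ?H" using delta_ring_UN_sub[OF D] by (simp add: subset_iff)
  qed
  moreover have "D \<subseteq> ?H" by (auto intro: delta_ring_Int[OF D])
  ultimately have "sigma_ring hull D \<subseteq> ?H" by (simp add: hull_minimal)
  with assms(2-4) have "X \<inter> Y \<in> D" by blast
  with \<open>Y \<subseteq> X\<close> show ?thesis by (simp add: Int_absorb1)
qed

text \<open>Differences and countable intersections lie in \<open>H\<close> and below a member of
  \<open>D\<close>, so the ideal property supplies them; only binary unions must be checked by hand.
  This serves for the domains of both premeasures constructed below.\<close>

lemma delta_ringI_ideal:
  assumes H: "sigma_ring H" and "D \<subseteq> H" "D \<noteq> {}"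
    and Un: "\<And>A B. A \<in> D \<Longrightarrow> B \<in> D \<Longrightarrow> A \<union> B \<in> D"
    and ideal: "\<And>X Y. X \<in> D \<Longrightarrow> Y \<in> H \<Longrightarrow> Y \<subseteq> X \<Longrightarrow> Y \<in> D"
  shows "delta_ring D"
  unfolding delta_ring_def ring_of_sets_UNIV_iff
proof (intro conjI ballI allI impI)
  show "A \<union> B \<in> D" if "A \<in> D" "B \<in> D" for A B using that by (rule Un)
  show "A - B \<in> D" if "A \<in> D" "B \<in> D" for A B
    using that(1)
  proof (rule ideal)
    show "A - B \<in> H" using that \<open>D \<subseteq> H\<close> by (auto intro: sigma_ring_closed(3)[OF H])
  qed auto
  fix C assume C: "C \<subseteq> D" "C \<noteq> {}" "countable C"
  then obtain X where X: "X \<in> C" by blast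
  \<comment> \<open>The intersection is rewritten with one fixed member \<open>X\<close>, using only
    the differences and countable unions that a sigma-ring offers.\<close>
  have "(\<lambda>Y. X - Y) ` C \<subseteq> H" "X \<in> H"
    using X C \<open>D \<subseteq> H\<close> by (auto intro!: sigma_ring_closed(3)[OF H])
  then have "X - \<Union>((\<lambda>Y. X - Y) ` C) \<in> H"
    by (metis sigma_ring_closed(3,4)[OF H] countable_image[OF C(3)])
  moreover have "X - \<Union>((\<lambda>Y. X - Y) ` C) = \<Inter>C" using X by auto
  ultimately show "\<Inter>C \<in> D" using ideal[of X "\<Inter>C"] X C by auto
qed (fact \<open>D \<noteq> {}\<close>)

text \<open>The countable unions of members of \<open>D\<close> already form a sigma-ring. The
  critical operation is the difference: removing a countable union from a single
  \<open>X \<in> D\<close> stays in \<open>D\<close> by \<open>delta_ring_UN_sub\<close>.\<close>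

lemma sigma_ring_hull_delta_ring:
  assumes D: "delta_ring D" and "B \<in> sigma_ring hull D"
  obtains C where "C \<subseteq> D" "countable C" "B = \<Union>C"
proof -
  let ?H = "{\<Union>C | C. C \<subseteq> D \<and> countable C}"
  have "sigma_ring ?H"
    unfolding sigma_ring_def ring_of_sets_UNIV_iff
  proof (intro conjI ballI allI impI)
    show "?H \<noteq> {}" by blast
  next
    fix A B assume "A \<in> ?H" "B \<in> ?H"
    then obtain C E where CE: "C \<subseteq> D" "countable C" "A = \<Union>C" "E \<subseteq> D" "countable E" "B = \<Union>E"
      by blast
    then have "A \<union> B = \<Union>(C \<union> E)" "C \<union> E \<subseteq> D" "countable (C \<union> E)" by auto
    then show "A \<union> B \<in> ?H" by blast
    have "X - B \<in> D" if "X \<in> C" for X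
    proof -
      have "X \<inter> \<Union>E \<in> D"
        using that CE by (intro delta_ring_UN_sub[OF D]) (auto intro: delta_ring_Int[OF D])
      then have "X - X \<inter> \<Union>E \<in> D" using that CE by (intro delta_ring_closed(3)[OF D]) auto
      then show ?thesis using CE by (simp add: Diff_Int)
    qed
    then have "(\<lambda>X. X - B) ` C \<subseteq> D" "countable ((\<lambda>X. X - B) ` C)" using CE by auto
    moreover have "A - B = \<Union>((\<lambda>X. X - B) ` C)" using CE by auto
    ultimately show "A - B \<in> ?H" by blast
  next
    fix S assume S: "S \<subseteq> ?H" "countable S"
    then have "\<forall>X\<in>S. \<exists>C. C \<subseteq> D \<and> countable C \<and> \<Union>C = X" by blast
    from bchoice[OF this] obtain f
      where f: "\<forall>X\<in>S. f X \<subseteq> D \<and> countable (f X) \<and> \<Union>(f X) = X" ..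
    have "\<Union>(\<Union>(f ` S)) = (\<Union>X\<in>S. \<Union>(f X))" by blast
    also have "\<dots> = \<Union>S" using f by simp
    finally have "\<Union>S = \<Union>(\<Union>(f ` S))" ..
    moreover have "\<Union>(f ` S) \<subseteq> D" "countable (\<Union>(f ` S))" using f S by auto
    ultimately show "\<Union>S \<in> ?H" by blast
  qed
  moreover have "D \<subseteq> ?H"
  proof
    fix X assume "X \<in> D"
    then have "X = \<Union>{X}" "{X} \<subseteq> D" "countable {X}" by auto
    then show "X \<in> ?H" by blast
  qed
  ultimately have "sigma_ring hull D \<subseteq> ?H" by (simp add: hull_minimal)
  with assms(2) that show thesis by blast
qed

lemma sigma_ring_hull_partition:
  assumes D: "delta_ring D" and "B \<in> sigma_ring hull D"
  obtains P where "partition_into D P (UNIV :: nat set) B"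
proof -
  obtain C where C: "C \<subseteq> D" "countable C" "B = \<Union>C"
    using sigma_ring_hull_delta_ring[OF assms] .
  \<comment> \<open>Adding the empty set makes the enumerated set nonempty, so that finite and empty
    \<open>C\<close> also give a sequence indexed by all of \<open>nat\<close>.\<close>
  define R where "R = from_nat_into (insert {} C)"
  have ran: "range R = insert {} C" using C by (simp add: R_def)
  have R: "R n \<in> D" for n using ran C delta_ring_closed(1)[OF D] by (metis insert_subset rangeI subsetD)
  have UR: "(\<Union>i\<in>{0..<n}. R i) \<in> D" for n
    by (induction n) (simp_all add: atLeast0_lessThan_Suc R delta_ring_closed(1,2)[OF D])
  have "partition_into D (disjointed R) UNIV B"
    unfolding partition_into_def
    using R UR C(3) ran disjoint_family_disjointed[of R] UN_disjointed_eq[of R]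
    by (auto simp: disjointed_def intro!: delta_ring_closed(3)[OF D])
  then show thesis by (rule that)
qed

section \<open>Basic properties of premeasures\<close>

lemma premeasure_delta_ring: "htm_premeasure \<mu> \<Longrightarrow> delta_ring (dom \<mu>)"
  by (simp add: htm_premeasure_def)

lemma dom_subset_host: "dom \<mu> \<subseteq> host \<mu>"
  by (simp add: host_def hull_subset)

lemma sigma_ring_host: "sigma_ring (host \<mu>)"
  by (simp add: host_def sigma_ring_hull)

lemma premeasure_ideal:
  assumes "htm_premeasure \<mu>" "X \<in> dom \<mu>" "Y \<in> host \<mu>" "Y \<subseteq> X"
  shows "Y \<in> dom \<mu>"
  using assms delta_ring_ideal[OF premeasure_delta_ring] unfolding host_def by blast

lemma host_eqI:
  assumes "dom \<mu> \<subseteq> dom \<nu>" "dom \<nu> \<subseteq> host \<mu>"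
  shows "host \<nu> = host \<mu>"
proof
  show "host \<mu> \<subseteq> host \<nu>" using assms(1) by (simp add: host_def hull_mono)
  show "host \<nu> \<subseteq> host \<mu>"
    using assms(2) sigma_ring_host[of \<mu>] by (simp add: host_def hull_minimal)
qed

lemma premeasure_has_sum:
  assumes "htm_premeasure \<mu>" "A \<in> dom \<mu>" "partition_into (dom \<mu>) P (I :: nat set) A"
  shows "((\<lambda>i. the (\<mu> (P i))) has_sum the (\<mu> A)) I"
  using htm_premeasure_countable[OF assms(1,2) _ assms(3)] by (simp add: has_sum_infsum)

lemma premeasureI:
  fixes \<mu> :: "'x set \<rightharpoonup> 'a::{topological_comm_monoid_add, t2_space}"
  assumes "delta_ring (dom \<mu>)"
    and "\<And>A (I :: nat set) P. A \<in> dom \<mu> \<Longrightarrow> partition_into (dom \<mu>) P I A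
      \<Longrightarrow> ((\<lambda>i. the (\<mu> (P i))) has_sum the (\<mu> A)) I"
  shows "htm_premeasure \<mu>"
  unfolding htm_premeasure_def
proof (intro conjI ballI allI impI)
  fix A I P assume "A \<in> dom \<mu>" "partition_into (dom \<mu>) P (I :: nat set) A"
  from assms(2)[OF this] show "(\<lambda>i. the (\<mu> (P i))) summable_on I"
    "the (\<mu> A) = (\<Sum>\<^sub>\<infinity>i\<in>I. the (\<mu> (P i)))"
    by (simp_all add: has_sum_imp_summable infsumI)
qed fact

lemma premeasure_empty:
  assumes "htm_premeasure \<mu>"
  shows "\<mu> {} = Some 0"
proof -
  have e: "{} \<in> dom \<mu>" using delta_ring_closed(1)[OF premeasure_delta_ring[OF assms]] .
  \<comment> \<open>The empty family partitions the empty set, and its sum is 0. Additivity over two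
    empty sets would not suffice, as a monoid need not be cancellative.\<close>
  have "((\<lambda>i. the (\<mu> {})) has_sum the (\<mu> {})) ({} :: nat set)"
    by (rule premeasure_has_sum[OF assms e]) (auto simp: partition_into_def disjoint_family_on_def)
  then have "the (\<mu> {}) = 0" by (simp add: has_sum_unique[OF _ has_sum_empty])
  with e show ?thesis by auto
qed

lemma premeasure_Un:
  assumes \<mu>: "htm_premeasure \<mu>" and "A \<in> dom \<mu>" "B \<in> dom \<mu>" "A \<inter> B = {}"
  shows "the (\<mu> (A \<union> B)) = the (\<mu> A) + the (\<mu> B)"
proof -
  let ?P = "\<lambda>i::nat. if i = 0 then A else B"
  have "partition_into (dom \<mu>) ?P {0, 1} (A \<union> B)"
    using assms by (auto simp: partition_into_def disjoint_family_on_def)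
  then have "((\<lambda>i. the (\<mu> (?P i))) has_sum the (\<mu> (A \<union> B))) {0, 1}"
    using delta_ring_closed(2)[OF premeasure_delta_ring[OF \<mu>]] assms
    by (intro premeasure_has_sum[OF \<mu>]) auto
  moreover have "((\<lambda>i. the (\<mu> (?P i))) has_sum (the (\<mu> A) + the (\<mu> B))) {0, 1}"
    by (rule has_sum_finiteI) auto
  ultimately show ?thesis by (rule has_sum_unique)
qed

text \<open>\<open>R\<close> may differ from \<open>Q\<close>: a partition into sets of a larger
  domain will be cut down to one into sets of a smaller domain.\<close>

lemma partition_into_Int:
  assumes "partition_into Q P I B" "A \<subseteq> B" "\<And>i. i \<in> I \<Longrightarrow> P i \<inter> A \<in> R"
  shows "partition_into R (\<lambda>i. P i \<inter> A) I A"
  unfolding partition_into_def disjoint_family_on_def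
proof (intro conjI ballI impI)
  show "(\<lambda>i. P i \<inter> A) ` I \<subseteq> R" "(\<Union>i\<in>I. P i \<inter> A) = A"
    using assms by (auto simp: partition_into_def)
  show "P i \<inter> A \<inter> (P j \<inter> A) = {}" if "i \<in> I" "j \<in> I" "i \<noteq> j" for i j
    using that assms(1) unfolding partition_into_def disjoint_family_on_def by blast
qed

section \<open>Similarity as an equivalence of premeasures\<close>

lemma similar_sym: "\<mu> \<asymp> \<nu> \<Longrightarrow> \<nu> \<asymp> \<mu>"
  by (auto simp: similar_def)

lemma similar_refl: "\<mu> \<asymp> \<mu>"
  by (simp add: similar_def)

text \<open>A common set \<open>A\<close> of \<open>\<kappa>\<close> and \<open>\<nu>\<close> need
  not belong to \<open>dom \<mu>\<close>, but it is a countable disjoint union of sets that do.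
  These pieces lie below \<open>A\<close>, hence in all three domains, where the values agree. Both
  values at \<open>A\<close> are then limits of the same net, and the topology is Hausdorff.\<close>

lemma similar_trans:
  assumes pre: "htm_premeasure \<kappa>" "htm_premeasure \<mu>" "htm_premeasure \<nu>"
    and sim: "\<kappa> \<asymp> \<mu>" "\<mu> \<asymp> \<nu>"
  shows "\<kappa> \<asymp> \<nu>"
  unfolding similar_def
proof (intro conjI ballI)
  have H: "host \<kappa> = host \<mu>" "host \<nu> = host \<mu>" using sim by (auto simp: similar_def)
  then show "host \<kappa> = host \<nu>" by simp
  fix A assume A: "A \<in> dom \<kappa> \<inter> dom \<nu>"
  then have "A \<in> host \<mu>" using dom_subset_host[of \<kappa>] H by auto
  then obtain P where P: "partition_into (dom \<mu>) P (UNIV :: nat set) A"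
    unfolding host_def by (rule sigma_ring_hull_partition[OF premeasure_delta_ring[OF pre(2)]])
  then have sub: "P i \<subseteq> A" and D: "P i \<in> dom \<mu>" for i by (auto simp: partition_into_def)
  then have "P i \<in> host \<mu>" for i using dom_subset_host[of \<mu>] by blast
  then have "P i \<in> dom \<kappa>" "P i \<in> dom \<nu>" for i
    using premeasure_ideal[OF pre(1)] premeasure_ideal[OF pre(3)] A sub H by blast+
  then have PP: "partition_into (dom \<kappa>) P UNIV A" "partition_into (dom \<nu>) P UNIV A"
    and "\<kappa> (P i) = \<nu> (P i)" for i
    using P D sim by (auto simp: partition_into_def similar_def Ball_def)
  then have "((\<lambda>i. the (\<nu> (P i))) has_sum the (\<kappa> A)) UNIV"
    using premeasure_has_sum[OF pre(1) _ PP(1)] A by simp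
  moreover have "((\<lambda>i. the (\<nu> (P i))) has_sum the (\<nu> A)) UNIV"
    using premeasure_has_sum[OF pre(3) _ PP(2)] A by simp
  ultimately have "the (\<kappa> A) = the (\<nu> A)" by (rule has_sum_unique)
  with A show "\<kappa> A = \<nu> A" by auto
qed

section \<open>Common extension of two similar premeasures\<close>

lemma similar_sum_unique:
  assumes pre: "htm_premeasure \<mu>" "htm_premeasure \<nu>" and sim: "\<mu> \<asymp> \<nu>"
    and 1: "A \<in> dom \<mu>" "B \<in> dom \<nu>" "A \<inter> B = {}"
    and 2: "A' \<in> dom \<mu>" "B' \<in> dom \<nu>" "A' \<inter> B' = {}"
    and eq: "A \<union> B = A' \<union> B'"
  shows "the (\<mu> A) + the (\<nu> B) = the (\<mu> A') + the (\<nu> B')"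
proof -
  have H: "host \<mu> = host \<nu>" using sim by (simp add: similar_def)
  have h: "A \<in> host \<nu>" "A' \<in> host \<nu>" "B \<in> host \<nu>" "B' \<in> host \<nu>"
    using 1 2 dom_subset_host[of \<mu>] dom_subset_host[of \<nu>] H by blast+
  have Int: "X \<inter> Y \<in> host \<nu>" if "X \<in> host \<nu>" "Y \<in> host \<nu>" for X Y
    using that sigma_ring_closed(3)[OF sigma_ring_host[of \<nu>]] by (metis Diff_Diff_Int)
  note id\<mu> = premeasure_ideal[OF pre(1)] and id\<nu> = premeasure_ideal[OF pre(2)]
  \<comment> \<open>Lacking subtraction, the two sums are compared through the common refinement
    into four intersections. The mixed ones, \<open>A \<inter> B'\<close> and
    \<open>A' \<inter> B\<close>, are measured by different maps on the two sides, but lie in both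
    domains, where \<open>\<mu>\<close> and \<open>\<nu>\<close> agree.\<close>
  have AA: "A \<inter> A' \<in> dom \<mu>" using id\<mu>[OF 1(1)] Int h H by simp
  have AB: "A \<inter> B' \<in> dom \<mu>" "A \<inter> B' \<in> dom \<nu>"
    using id\<mu>[OF 1(1)] id\<nu>[OF 2(2)] Int h H by simp_all
  have BA: "A' \<inter> B \<in> dom \<mu>" "A' \<inter> B \<in> dom \<nu>"
    using id\<mu>[OF 2(1)] id\<nu>[OF 1(2)] Int h H by simp_all
  have BB: "B \<inter> B' \<in> dom \<nu>" using id\<nu>[OF 1(2)] Int h by simp
  have e: "A \<inter> A' \<union> A \<inter> B' = A" "A \<inter> A' \<union> A' \<inter> B = A'"
    "A' \<inter> B \<union> B \<inter> B' = B" "A \<inter> B' \<union> B \<inter> B' = B'"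
    using eq by blast+
  have dj: "(A \<inter> A') \<inter> (A \<inter> B') = {}" "(A \<inter> A') \<inter> (A' \<inter> B) = {}"
    "(A' \<inter> B) \<inter> (B \<inter> B') = {}" "(A \<inter> B') \<inter> (B \<inter> B') = {}"
    using 1(3) 2(3) by blast+
  note s = premeasure_Un[OF pre(1) AA AB(1) dj(1), unfolded e]
    premeasure_Un[OF pre(1) AA BA(1) dj(2), unfolded e]
    premeasure_Un[OF pre(2) BA(2) BB dj(3), unfolded e]
    premeasure_Un[OF pre(2) AB(2) BB dj(4), unfolded e]
  have "\<mu> (A \<inter> B') = \<nu> (A \<inter> B')" "\<mu> (A' \<inter> B) = \<nu> (A' \<inter> B)"
    using sim AB BA by (auto simp: similar_def)
  then show ?thesis unfolding s by (simp add: ac_simps)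
qed

text \<open>Additivity forces the value on a disjoint union, and \<open>similar_sum_unique\<close>
  makes it independent of the decomposition. This yields the directedness needed to glue all similar
  premeasures.\<close>

lemma similar_common_extension:
  fixes \<mu> \<nu> :: "'x set \<rightharpoonup> 'a::{topological_comm_monoid_add, t2_space}"
  assumes pre: "htm_premeasure \<mu>" "htm_premeasure \<nu>" and sim: "\<mu> \<asymp> \<nu>"
  obtains \<kappa> where "htm_premeasure \<kappa>" "\<kappa> \<asymp> \<mu>" "\<mu> \<subseteq>\<^sub>m \<kappa>" "\<nu> \<subseteq>\<^sub>m \<kappa>"
proof -
  define split where
    "split C A B \<longleftrightarrow> A \<in> dom \<mu> \<and> B \<in> dom \<nu> \<and> A \<inter> B = {} \<and> C = A \<union> B" for C A B
  \<comment> \<open>The choice is made among values rather than decompositions; the next fact shows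
    that there is only one candidate.\<close>
  define \<kappa> where "\<kappa> C = (if \<exists>A B. split C A B
      then Some (SOME v. \<exists>A B. split C A B \<and> v = the (\<mu> A) + the (\<nu> B)) else None)" for C
  have \<kappa>: "\<kappa> C = Some (the (\<mu> A) + the (\<nu> B))" if "split C A B" for A B C
  proof -
    have "\<exists>v A B. split C A B \<and> v = the (\<mu> A) + the (\<nu> B)" using that by blast
    from someI_ex[OF this] obtain A' B' where "split C A' B'"
      and v: "(SOME v. \<exists>A B. split C A B \<and> v = the (\<mu> A) + the (\<nu> B)) = the (\<mu> A') + the (\<nu> B')"
      by auto
    then have "the (\<mu> A') + the (\<nu> B') = the (\<mu> A) + the (\<nu> B)"
      using that by (intro similar_sum_unique[OF pre sim]) (auto simp: split_def)
    with v that show ?thesis by (auto simp: \<kappa>_def)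
  qed
  have dom: "C \<in> dom \<kappa> \<longleftrightarrow> (\<exists>A B. split C A B)" for C by (auto simp: \<kappa>_def dom_def)
  define H where "H = host \<mu>"
  have H: "host \<mu> = H" "host \<nu> = H" using sim by (auto simp: similar_def H_def)
  then have "sigma_ring H" and D: "dom \<mu> \<subseteq> H" "dom \<nu> \<subseteq> H"
    using sigma_ring_host[of \<mu>] dom_subset_host[of \<mu>] dom_subset_host[of \<nu>] by auto
  note sr = sigma_ring_closed[OF \<open>sigma_ring H\<close>]
  note id = premeasure_ideal[OF pre(1), unfolded H] premeasure_ideal[OF pre(2), unfolded H]
  have Int: "X \<inter> Y \<in> H" if "X \<in> H" "Y \<in> H" for X Y
    using that sr(3) by (metis Diff_Diff_Int)
  \<comment> \<open>Decompositions restrict to any \<open>Y\<close> in the host, because both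
    domains are ideals in it. This gives the ideal property of \<open>dom \<kappa>\<close> and also
    decomposes the members of a partition.\<close>
  have split_Int: "split (Y \<inter> C) (Y \<inter> A) (Y \<inter> B)" if "split C A B" "Y \<in> H" for Y A B C
    using that D id(1)[of A "Y \<inter> A"] id(2)[of B "Y \<inter> B"] unfolding split_def
    by (simp add: Int subset_iff) blast
  \<comment> \<open>Disjointness costs nothing: the overlap can be left to \<open>\<nu>\<close>.
    Closure of \<open>dom \<kappa>\<close> under unions follows by joining the two parts
    separately.\<close>
  have split_Un: "split (A \<union> B) (A - B) B" if "A \<in> dom \<mu>" "B \<in> dom \<nu>" for A B
    using that D id(1)[of A "A - B"] unfolding split_def
    by (simp add: sr(3) subset_iff) blast
  have dom_H: "dom \<kappa> \<subseteq> H"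
  proof
    fix C assume "C \<in> dom \<kappa>"
    then obtain A B where "split C A B" using dom by blast
    then show "C \<in> H" using D sr(2) unfolding split_def by blast
  qed
  have ext: "\<mu> \<subseteq>\<^sub>m \<kappa>" "\<nu> \<subseteq>\<^sub>m \<kappa>"
  proof -
    have "\<mu> A = \<kappa> A" if "A \<in> dom \<mu>" for A
    proof -
      have "split A A {}" using that premeasure_empty[OF pre(2)] by (auto simp: split_def)
      from \<kappa>[OF this] show ?thesis using that premeasure_empty[OF pre(2)] by auto
    qed
    then show "\<mu> \<subseteq>\<^sub>m \<kappa>" by (simp add: map_le_def)
    have "\<nu> A = \<kappa> A" if "A \<in> dom \<nu>" for A
    proof -
      have "split A {} A" using that premeasure_empty[OF pre(1)] by (auto simp: split_def)
      from \<kappa>[OF this] show ?thesis using that premeasure_empty[OF pre(1)] by auto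
    qed
    then show "\<nu> \<subseteq>\<^sub>m \<kappa>" by (simp add: map_le_def)
  qed
  have "htm_premeasure \<kappa>"
  proof (rule premeasureI)
    show "delta_ring (dom \<kappa>)"
    proof (rule delta_ringI_ideal[OF \<open>sigma_ring H\<close> dom_H])
      show "dom \<kappa> \<noteq> {}"
        using map_le_implies_dom_le[OF ext(1)] premeasure_empty[OF pre(1)] by blast
    next
      fix A B assume "A \<in> dom \<kappa>" "B \<in> dom \<kappa>"
      then obtain A1 A2 B1 B2 where "split A A1 A2" "split B B1 B2" by (auto simp: dom)
      then have "A \<union> B = (A1 \<union> B1) \<union> (A2 \<union> B2)" "A1 \<union> B1 \<in> dom \<mu>" "A2 \<union> B2 \<in> dom \<nu>"
        unfolding split_def
        using delta_ring_closed(2)[OF premeasure_delta_ring[OF pre(1)], of A1 B1]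
          delta_ring_closed(2)[OF premeasure_delta_ring[OF pre(2)], of A2 B2]
        by blast+
      then show "A \<union> B \<in> dom \<kappa>" using split_Un dom by metis
    next
      fix X Y assume "X \<in> dom \<kappa>" "Y \<in> H" "Y \<subseteq> X"
      then show "Y \<in> dom \<kappa>" using split_Int dom by (metis Int_absorb2)
    qed
  next
    fix C P and I :: "nat set" assume C: "C \<in> dom \<kappa>" and P: "partition_into (dom \<kappa>) P I C"
    obtain A B where AB: "split C A B" using C dom by auto
    have Pi: "P i \<in> H" "P i \<subseteq> C" if "i \<in> I" for i
      using that P dom_H unfolding partition_into_def by blast+
    then have sp: "split (P i) (P i \<inter> A) (P i \<inter> B)" if "i \<in> I" for i
      using split_Int[OF AB Pi(1)[OF that]] that by (simp add: Int_absorb2)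
    \<comment> \<open>The partition of \<open>C\<close> is cut along \<open>A\<close> and
      \<open>B\<close>, and the two convergent sums are added by continuity of addition.\<close>
    have "partition_into (dom \<mu>) (\<lambda>i. P i \<inter> A) I A" "partition_into (dom \<nu>) (\<lambda>i. P i \<inter> B) I B"
      using AB sp by (auto simp: split_def intro!: partition_into_Int[OF P])
    then have "((\<lambda>i. the (\<mu> (P i \<inter> A)) + the (\<nu> (P i \<inter> B))) has_sum the (\<mu> A) + the (\<nu> B)) I"
      using AB by (intro has_sum_add premeasure_has_sum pre) (auto simp: split_def)
    moreover have "((\<lambda>i. the (\<kappa> (P i))) has_sum s) I
        \<longleftrightarrow> ((\<lambda>i. the (\<mu> (P i \<inter> A)) + the (\<nu> (P i \<inter> B))) has_sum s) I" for s
      by (rule has_sum_cong) (simp add: \<kappa>[OF sp])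
    ultimately show "((\<lambda>i. the (\<kappa> (P i))) has_sum the (\<kappa> C)) I" by (simp add: \<kappa>[OF AB])
  qed
  moreover have "\<kappa> \<asymp> \<mu>"
    unfolding similar_def
  proof
    show "host \<kappa> = host \<mu>"
      using map_le_implies_dom_le[OF ext(1)] dom_H unfolding H_def by (rule host_eqI)
    show "\<forall>A\<in>dom \<kappa> \<inter> dom \<mu>. \<kappa> A = \<mu> A" using ext(1) by (simp add: map_le_def)
  qed
  ultimately show thesis using ext by (rule that)
qed

section \<open>Gluing all premeasures similar to a given one\<close>

lemma largest_similar_premeasure:
  fixes \<mu> :: "'x set \<rightharpoonup> 'a::{topological_comm_monoid_add, t2_space}"
  assumes \<mu>: "htm_premeasure \<mu>"
  obtains \<nu> where "htm_premeasure \<nu>" "\<nu> \<asymp> \<mu>"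
    "\<And>\<kappa>. htm_premeasure \<kappa> \<Longrightarrow> \<kappa> \<asymp> \<mu> \<Longrightarrow> \<kappa> \<subseteq>\<^sub>m \<nu>"
proof -
  define S where "S = {\<kappa>. htm_premeasure \<kappa> \<and> \<kappa> \<asymp> \<mu>}"
  \<comment> \<open>The chosen member does not matter: any two members of \<open>S\<close> are
    similar via \<open>\<mu>\<close>, so they agree wherever both are defined.\<close>
  define \<nu> where "\<nu> A = (if \<exists>\<kappa>\<in>S. A \<in> dom \<kappa> then (SOME \<kappa>. \<kappa> \<in> S \<and> A \<in> dom \<kappa>) A else None)" for A
  have S: "htm_premeasure \<kappa>" "\<kappa> \<asymp> \<mu>" "host \<kappa> = host \<mu>" if "\<kappa> \<in> S" for \<kappa>
    using that by (auto simp: S_def similar_def)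
  have S_sim: "\<kappa> \<asymp> \<tau>" if "\<kappa> \<in> S" "\<tau> \<in> S" for \<kappa> \<tau>
    using similar_trans[OF S(1)[OF that(1)] \<mu> S(1)[OF that(2)] S(2)[OF that(1)]
        similar_sym[OF S(2)[OF that(2)]]] .
  have \<mu>S: "\<mu> \<in> S" using \<mu> by (simp add: S_def similar_refl)
  have \<nu>: "\<nu> A = \<kappa> A" if "\<kappa> \<in> S" "A \<in> dom \<kappa>" for A \<kappa>
  proof -
    have "\<exists>\<kappa>. \<kappa> \<in> S \<and> A \<in> dom \<kappa>" using that by blast
    from someI_ex[OF this] have "(SOME \<kappa>. \<kappa> \<in> S \<and> A \<in> dom \<kappa>) A = \<kappa> A"
      using S_sim[OF _ that(1)] that(2) by (simp add: similar_def)
    with that show ?thesis by (auto simp: \<nu>_def)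
  qed
  have dom: "A \<in> dom \<nu> \<longleftrightarrow> (\<exists>\<kappa>\<in>S. A \<in> dom \<kappa>)" for A
    using \<nu> by (metis \<nu>_def domIff)
  have ideal: "Y \<in> dom \<kappa>" if "\<kappa> \<in> S" "X \<in> dom \<kappa>" "Y \<in> host \<mu>" "Y \<subseteq> X" for X Y \<kappa>
    using premeasure_ideal[OF S(1)[OF that(1)] that(2)] S(3)[OF that(1)] that(3,4) by simp
  have dom_host: "dom \<nu> \<subseteq> host \<mu>"
  proof
    fix A assume "A \<in> dom \<nu>"
    then obtain \<kappa> where "\<kappa> \<in> S" "A \<in> dom \<kappa>" using dom by auto
    then show "A \<in> host \<mu>" using S(3)[of \<kappa>] dom_subset_host[of \<kappa>] by auto
  qed
  have pre: "htm_premeasure \<nu>"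
  proof (rule premeasureI)
    show "delta_ring (dom \<nu>)"
    proof (rule delta_ringI_ideal[OF sigma_ring_host dom_host])
      have "{} \<in> dom \<nu>" using dom[of "{}"] \<mu>S premeasure_empty[OF \<mu>] by auto
      then show "dom \<nu> \<noteq> {}" by (metis empty_iff)
    next
      fix A B assume "A \<in> dom \<nu>" "B \<in> dom \<nu>"
      then obtain \<kappa> \<tau> where kl: "\<kappa> \<in> S" "A \<in> dom \<kappa>" "\<tau> \<in> S" "B \<in> dom \<tau>" by (auto simp: dom)
      \<comment> \<open>Two sets from different domains are brought into one domain by a common
        extension, which again belongs to \<open>S\<close>.\<close>
      then obtain \<rho> where \<rho>: "htm_premeasure \<rho>" "\<rho> \<asymp> \<kappa>" "\<kappa> \<subseteq>\<^sub>m \<rho>" "\<tau> \<subseteq>\<^sub>m \<rho>"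
        using similar_common_extension[OF S(1) S(1) S_sim] by metis
      then have "\<rho> \<in> S"
        using similar_trans[OF \<rho>(1) S(1)[OF kl(1)] \<mu> \<rho>(2) S(2)[OF kl(1)]] by (simp add: S_def)
      moreover have "A \<union> B \<in> dom \<rho>"
        using \<rho> kl delta_ring_closed(2)[OF premeasure_delta_ring[OF \<rho>(1)]]
        by (meson map_le_implies_dom_le subsetD)
      ultimately show "A \<union> B \<in> dom \<nu>" using dom[of "A \<union> B"] by auto
    next
      fix X Y assume "X \<in> dom \<nu>" "Y \<in> host \<mu>" "Y \<subseteq> X"
      moreover from this obtain \<kappa> where "\<kappa> \<in> S" "X \<in> dom \<kappa>" using dom[of X] by auto
      ultimately show "Y \<in> dom \<nu>" using dom[of Y] ideal[of \<kappa> X Y] by auto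
    qed
  next
    fix A P and I :: "nat set" assume A: "A \<in> dom \<nu>" and P: "partition_into (dom \<nu>) P I A"
    obtain \<kappa> where \<kappa>: "\<kappa> \<in> S" "A \<in> dom \<kappa>" using A dom[of A] by auto
    \<comment> \<open>A single \<open>\<kappa>\<close> defined at \<open>A\<close> is defined on the
      whole partition, since its domain is an ideal in the host. No passage to a limit along the
      directed family is required.\<close>
    have "P i \<in> dom \<kappa>" if "i \<in> I" for i
    proof (rule ideal[OF \<kappa>])
      show "P i \<in> host \<mu>" "P i \<subseteq> A"
        using that P dom_host unfolding partition_into_def by blast+
    qed
    then have "partition_into (dom \<kappa>) P I A" and eq: "\<And>i. i \<in> I \<Longrightarrow> \<nu> (P i) = \<kappa> (P i)"
      using P \<nu>[OF \<kappa>(1)] by (auto simp: partition_into_def)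
    then have "((\<lambda>i. the (\<kappa> (P i))) has_sum the (\<kappa> A)) I"
      using \<kappa> S by (intro premeasure_has_sum)
    moreover have "((\<lambda>i. the (\<nu> (P i))) has_sum s) I \<longleftrightarrow> ((\<lambda>i. the (\<kappa> (P i))) has_sum s) I" for s
      by (rule has_sum_cong) (simp add: eq)
    ultimately show "((\<lambda>i. the (\<nu> (P i))) has_sum the (\<nu> A)) I" by (simp add: \<nu>[OF \<kappa>])
  qed
  have ext: "\<kappa> \<subseteq>\<^sub>m \<nu>" if "htm_premeasure \<kappa>" "\<kappa> \<asymp> \<mu>" for \<kappa>
    using that \<nu> by (simp add: S_def map_le_def)
  have "\<nu> \<asymp> \<mu>"
    unfolding similar_def
  proof
    show "host \<nu> = host \<mu>"
      using map_le_implies_dom_le[OF ext[OF \<mu> similar_refl]] dom_host by (rule host_eqI)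
    show "\<forall>A\<in>dom \<nu> \<inter> dom \<mu>. \<nu> A = \<mu> A" using \<nu>[OF \<mu>S] by simp
  qed
  with pre show thesis using ext by (rule that)
qed

theorem theorem5p5:
  fixes \<mu> :: "'x set \<rightharpoonup> 'a::{topological_comm_monoid_add, t2_space}"
  assumes "htm_premeasure \<mu>"
  shows "\<exists>!\<nu>. htm_measure \<nu> \<and> \<nu> \<asymp> \<mu>"
proof -
  obtain \<nu> where \<nu>: "htm_premeasure \<nu>" "\<nu> \<asymp> \<mu>"
    and max: "\<And>\<kappa>. htm_premeasure \<kappa> \<Longrightarrow> \<kappa> \<asymp> \<mu> \<Longrightarrow> \<kappa> \<subseteq>\<^sub>m \<nu>"
    by (rule largest_similar_premeasure[OF assms]) blast
  show ?thesis
  proof (intro ex1I conjI)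
    show "htm_measure \<nu>"
      unfolding htm_measure_def
    proof (intro conjI allI impI)
      \<comment> \<open>Transitivity turns similarity to \<open>\<nu>\<close> into similarity to
        \<open>\<mu>\<close>, where \<open>\<nu>\<close> is known to be largest.\<close>
      fix \<kappa> assume \<kappa>: "htm_premeasure \<kappa> \<and> \<kappa> \<asymp> \<nu>"
      then have "\<kappa> \<asymp> \<mu>" using similar_trans[OF _ \<nu>(1) assms _ \<nu>(2)] by simp
      with \<kappa> show "\<kappa> \<subseteq>\<^sub>m \<nu>" by (simp add: max)
    qed (fact \<nu>(1))
    show "\<nu> \<asymp> \<mu>" by fact
    \<comment> \<open>Uniqueness comes from two extensions: \<open>\<kappa>\<close> extends
      \<open>\<nu>\<close> because it is a measure, and \<open>\<nu>\<close> extends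
      \<open>\<kappa>\<close> because it is largest.\<close>
    fix \<kappa> assume \<kappa>: "htm_measure \<kappa> \<and> \<kappa> \<asymp> \<mu>"
    then have "htm_premeasure \<kappa>" by (simp add: htm_measure_def)
    then have "\<nu> \<asymp> \<kappa>"
      using similar_trans[OF \<nu>(1) assms _ \<nu>(2)] \<kappa> by (simp add: similar_sym)
    then have "\<nu> \<subseteq>\<^sub>m \<kappa>" using \<kappa> \<nu>(1) unfolding htm_measure_def by simp
    moreover have "\<kappa> \<subseteq>\<^sub>m \<nu>" using max \<kappa> \<open>htm_premeasure \<kappa>\<close> by simp
    ultimately show "\<kappa> = \<nu>" by (simp add: map_le_antisym)
  qed
qed

end
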